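(* Let $\mathcal{M}\subseteq\mathcal{V}$, $u\in\mathcal{V}$, and let $u_{\mathcal{M}}\in\arg\min_{v\in\mathcal{M}}\|u-v\|$. Let $\mathcal{N}\subseteq\mathcal{M}$ be a manifold and a neighbourhood of $u_{\mathcal{M}}$ (in $\mathcal{M}$), and assume that $\operatorname{rch}(\mathcal{N},u_{\mathcal{M}})>0$. Then, pointwise on $Y$, $$\mathfrak{K}_{\mathbb{T}_{u_{\mathcal{M}}}\mathcal{N}} \le \mathfrak{K}_{\{u_{\mathcal{M}}\}-\mathcal{N}} .$$
   Context: Let $\rho$ be a probability measure on a set $Y$ and $\|\cdot\| := \|\cdot\|_{L^2(Y,\rho)}$. Let $w$ be a weight function on $Y$, i.e. $w>0$ almost everywhere and $\int_Y w^{-1}\,\mathrm{d}\rho=1$. Define $$\mathcal{V} := \mathcal{V}_{w,\infty} := \{v\in L^\infty(Y,\rho) : \|v\|_{w,\infty}<\infty\},\qquad \|v\|_{w,\infty} := \operatorname{ess\,sup}_{y\in Y}\sqrt{w(y)}\,|v(y)|.$$ Functions are assumed to have point evaluations $v(y)$ at all $y\in Y$. The variation function of a set $A\subseteq\mathcal{V}$ is $$\mathfrak{K}_A(y) := \sup_{a\in U(A)}|a(y)|^2,\qquad U(A) := \{a/\|a\| : a\in A\setminus\{0\}\}$$ (the supremum over the empty set being $0$). $B(v,r)$ is the open ball of radius $r$ around $v$ with respect to $\|\cdot\|$. A manifold $\mathcal{N}\subseteq\mathcal{V}$ is a $\mathcal{C}^1$ submanifold of Euclidean space, i.e. of a finite-dimensional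 linear subspace of $\mathcal{V}$ equipped with the $L^2(Y,\rho)$ inner product; $\mathbb{T}_x\mathcal{N}$ is its tangent space at $x$ (a linear subspace). Local reach: for $A\subseteq\mathcal{V}$ let $P_A v := \arg\min_{a\in A}\|v-a\|$ and let $\operatorname{dom}(P_A)$ be the set of $v\in\mathcal{V}$ for which this minimiser exists and is unique. For $v\in A$, $\operatorname{rch}(A,v) := \sup\{r\ge0 : B(v,r)\subseteq\operatorname{dom}(P_A)\}\in[0,\infty]$. *)

theory Defs
  imports "HOL-Probability.Probability"
begin

text \<open>
  Functions on \<open>Y = space \<rho>\<close> are honest real-valued functions, so that point evaluations make
  sense; as elements of \<open>L\<^sup>2\<close> or \<open>L\<^sup>\<infinity>\<close> they are compared almost everywhere. In particular
  ``nonzero'' and ``unique'' below are understood up to \<open>\<rho>\<close>-null sets.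
\<close>

definition weight_function :: "'y measure \<Rightarrow> ('y \<Rightarrow> real) \<Rightarrow> bool" where
  "weight_function \<rho> w \<longleftrightarrow>
     w \<in> borel_measurable \<rho> \<and> (AE y in \<rho>. 0 < w y) \<and> (\<integral>\<^sup>+ y. ennreal (inverse (w y)) \<partial>\<rho>) = 1"

definition weighted_sup_norm :: "'y measure \<Rightarrow> ('y \<Rightarrow> real) \<Rightarrow> ('y \<Rightarrow> real) \<Rightarrow> ereal" where
  "weighted_sup_norm \<rho> w v = esssup \<rho> (\<lambda>y. ereal (sqrt (w y) * \<bar>v y\<bar>))"

definition weighted_space :: "'y measure \<Rightarrow> ('y \<Rightarrow> real) \<Rightarrow> ('y \<Rightarrow> real) set" where
  "weighted_space \<rho> w =
     {v \<in> borel_measurable \<rho>. esssup \<rho> (\<lambda>y. ereal \<bar>v y\<bar>) < \<infinity> \<and> weighted_sup_norm \<rho> w v < \<infinity>}"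

text \<open>
  Elements \<open>v\<close> of the weighted space satisfy \<open>v\<^sup>2 \<le> C / w\<close> almost everywhere, so the integral
  below is a genuine (finite) one for them.
\<close>

definition l2_norm :: "'y measure \<Rightarrow> ('y \<Rightarrow> real) \<Rightarrow> real" where
  "l2_norm \<rho> v = sqrt (\<integral>y. (v y)\<^sup>2 \<partial>\<rho>)"

definition l2_ball :: "'y measure \<Rightarrow> ('y \<Rightarrow> real) \<Rightarrow> ('y \<Rightarrow> real) \<Rightarrow> real \<Rightarrow> ('y \<Rightarrow> real) set" where
  "l2_ball \<rho> w v r = {x \<in> weighted_space \<rho> w. l2_norm \<rho> (\<lambda>y. x y - v y) < r}"

definition normalised :: "'y measure \<Rightarrow> ('y \<Rightarrow> real) set \<Rightarrow> ('y \<Rightarrow> real) set" where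
  "normalised \<rho> A = {(\<lambda>y. a y / l2_norm \<rho> a) | a. a \<in> A \<and> \<not> (AE y in \<rho>. a y = 0)}"

definition variation :: "'y measure \<Rightarrow> ('y \<Rightarrow> real) set \<Rightarrow> 'y \<Rightarrow> ennreal" where
  "variation \<rho> A y = (SUP a \<in> normalised \<rho> A. ennreal (\<bar>a y\<bar>\<^sup>2))"

definition is_best_approx ::
  "'y measure \<Rightarrow> ('y \<Rightarrow> real) set \<Rightarrow> ('y \<Rightarrow> real) \<Rightarrow> ('y \<Rightarrow> real) \<Rightarrow> bool" where
  "is_best_approx \<rho> A v = is_arg_min (\<lambda>a. l2_norm \<rho> (\<lambda>y. v y - a y)) (\<lambda>a. a \<in> A)"

definition proj_dom :: "'y measure \<Rightarrow> ('y \<Rightarrow> real) \<Rightarrow> ('y \<Rightarrow> real) set \<Rightarrow> ('y \<Rightarrow> real) set" where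
  "proj_dom \<rho> w A =
     {v \<in> weighted_space \<rho> w.
        \<exists>a. is_best_approx \<rho> A v a \<and> (\<forall>b. is_best_approx \<rho> A v b \<longrightarrow> (AE y in \<rho>. b y = a y))}"

definition local_reach ::
  "'y measure \<Rightarrow> ('y \<Rightarrow> real) \<Rightarrow> ('y \<Rightarrow> real) set \<Rightarrow> ('y \<Rightarrow> real) \<Rightarrow> ereal" where
  "local_reach \<rho> w A v = Sup {ereal r | r. 0 \<le> r \<and> l2_ball \<rho> w v r \<subseteq> proj_dom \<rho> w A}"

definition is_neighbourhood_in ::
  "'y measure \<Rightarrow> ('y \<Rightarrow> real) \<Rightarrow> ('y \<Rightarrow> real) set \<Rightarrow> ('y \<Rightarrow> real) \<Rightarrow> ('y \<Rightarrow> real) set \<Rightarrow> bool" where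
  "is_neighbourhood_in \<rho> w M x N \<longleftrightarrow>
     x \<in> N \<and> N \<subseteq> M \<and> (\<exists>r>0. l2_ball \<rho> w x r \<inter> M \<subseteq> N)"

definition C1_diffeomorphism ::
  "'a::euclidean_space set \<Rightarrow> 'a set \<Rightarrow> ('a \<Rightarrow> 'a) \<Rightarrow> ('a \<Rightarrow> 'a) \<Rightarrow> bool" where
  "C1_diffeomorphism U V \<phi> \<psi> \<longleftrightarrow>
     open U \<and> open V \<and> homeomorphism U V \<phi> \<psi> \<and>
     (\<exists>\<phi>'. (\<forall>x\<in>U. (\<phi> has_derivative blinfun_apply (\<phi>' x)) (at x)) \<and> continuous_on U \<phi>') \<and>
     (\<exists>\<psi>'. (\<forall>x\<in>V. (\<psi> has_derivative blinfun_apply (\<psi>' x)) (at x)) \<and> continuous_on V \<psi>')"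

definition C1_submanifold :: "nat \<Rightarrow> 'a::euclidean_space set \<Rightarrow> bool" where
  "C1_submanifold d S \<longleftrightarrow>
     (\<forall>x\<in>S. \<exists>U V \<phi> \<psi> L. x \<in> U \<and> C1_diffeomorphism U V \<phi> \<psi> \<and> subspace L \<and> dim L = d \<and>
        \<phi> ` (S \<inter> U) = L \<inter> V)"

definition tangent_space :: "'a::euclidean_space set \<Rightarrow> 'a \<Rightarrow> 'a set" where
  "tangent_space S x =
     {t. \<exists>\<epsilon>>0. \<exists>\<gamma>. \<gamma> C1_differentiable_on {-\<epsilon><..<\<epsilon>} \<and> \<gamma> ` {-\<epsilon><..<\<epsilon>} \<subseteq> S \<and> \<gamma> 0 = x \<and>
        (\<gamma> has_vector_derivative t) (at 0)}"

text \<open>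
  \<open>euclidean_coords \<rho> w \<iota>\<close>: the set \<open>range \<iota>\<close> is a finite-dimensional linear subspace of the weighted
  space on which the \<open>L\<^sup>2\<close> inner product is definite, and \<open>\<iota>\<close> identifies it isometrically with a
  Euclidean space \<open>'e\<close>. (Choosing an orthonormal basis, every such subspace of positive dimension
  arises in this way; the zero subspace lies in a one-dimensional one.)
\<close>

definition euclidean_coords ::
  "'y measure \<Rightarrow> ('y \<Rightarrow> real) \<Rightarrow> ('e::euclidean_space \<Rightarrow> 'y \<Rightarrow> real) \<Rightarrow> bool" where
  "euclidean_coords \<rho> w \<iota> \<longleftrightarrow>
     range \<iota> \<subseteq> weighted_space \<rho> w \<and> (\<forall>y. linear (\<lambda>x. \<iota> x y)) \<and>
     (\<forall>x x'. (\<integral>y. \<iota> x y * \<iota> x' y \<partial>\<rho>) = x \<bullet> x')"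

definition manifold_of_functions ::
  "('e::euclidean_space \<Rightarrow> 'y \<Rightarrow> real) \<Rightarrow> ('y \<Rightarrow> real) set \<Rightarrow> bool" where
  "manifold_of_functions \<iota> N \<longleftrightarrow> N \<subseteq> range \<iota> \<and> (\<exists>d. C1_submanifold d (\<iota> -` N))"

definition tangent_functions ::
  "('e::euclidean_space \<Rightarrow> 'y \<Rightarrow> real) \<Rightarrow> ('y \<Rightarrow> real) set \<Rightarrow> ('y \<Rightarrow> real) \<Rightarrow> ('y \<Rightarrow> real) set" where
  "tangent_functions \<iota> N x = {\<iota> t | t p. \<iota> p = x \<and> t \<in> tangent_space (\<iota> -` N) p}"

end

theory Submission
  imports Defs
begin

text \<open>
  If \<open>\<gamma>\<close> is a curve in \<open>N\<close> through \<open>u\<^sub>M\<close> with velocity \<open>t \<noteq> 0\<close>, then the normalised secants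
  \<open>(u\<^sub>M - \<gamma> s) / \<parallel>u\<^sub>M - \<gamma> s\<parallel>\<close> converge, up to sign, to \<open>t / \<parallel>t\<parallel>\<close> as \<open>s \<rightarrow> 0\<close>. Point evaluations are
  continuous on a finite-dimensional space, so the squared values at \<open>y\<close> converge as well, and the
  limit is at most the supremum over all secants.
\<close>

lemma euclidean_coords_l2_norm:
  assumes "euclidean_coords \<rho> w \<iota>"
  shows "l2_norm \<rho> (\<iota> x) = norm x"
  using assms by (simp add: euclidean_coords_def l2_norm_def power2_eq_square norm_eq_sqrt_inner)

text \<open>The isometry turns a vanishing integral into \<open>x \<bullet> x = 0\<close>. This
  translates "nonzero up to null sets" in \<open>normalised\<close> into
  \<open>x \<noteq> 0\<close>.\<close>

lemma euclidean_coords_AE_zero_iff: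
  assumes "euclidean_coords \<rho> w \<iota>"
  shows "(AE y in \<rho>. \<iota> x y = 0) \<longleftrightarrow> x = 0"
proof
  assume "AE y in \<rho>. \<iota> x y = 0"
  then have "(\<integral>y. \<iota> x y * \<iota> x y \<partial>\<rho>) = 0"
    by (intro integral_eq_zero_AE) auto
  with assms show "x = 0"
    by (simp add: euclidean_coords_def)
next
  assume "x = 0"
  then show "AE y in \<rho>. \<iota> x y = 0"
    using linear_0[of "\<lambda>x. \<iota> x y" for y] assms by (simp add: euclidean_coords_def)
qed

text \<open>Moves the supremum into coordinates, so that the comparison of variations becomes a
  statement about one linear functional on a Euclidean space.\<close>

lemma variation_euclidean_coords:
  assumes "euclidean_coords \<rho> w \<iota>"
  shows "variation \<rho> (\<iota> ` A) y = (SUP x \<in> A - {0}. ennreal ((\<iota> x y / norm x)\<^sup>2))"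
proof -
  have "normalised \<rho> (\<iota> ` A) = (\<lambda>x y. \<iota> x y / norm x) ` (A - {0})"
    unfolding normalised_def
    by (force simp: euclidean_coords_l2_norm[OF assms] euclidean_coords_AE_zero_iff[OF assms])
  then show ?thesis
    by (simp add: variation_def image_image)
qed

text \<open>The core limit argument, for an arbitrary linear functional \<open>f\<close>; it is
  later applied to evaluation at \<open>y\<close>, which is continuous because the dimension is
  finite.\<close>

lemma tangent_quotient_le_SUP_secants:
  fixes f :: "'e::euclidean_space \<Rightarrow> real"
  assumes f: "linear f" and t: "t \<in> tangent_space S p" "t \<noteq> 0"
  shows "ennreal ((f t / norm t)\<^sup>2) \<le> (SUP x \<in> (\<lambda>q. p - q) ` S - {0}. ennreal ((f x / norm x)\<^sup>2))"
    (is "_ \<le> ?sup")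
proof -
  obtain \<epsilon> \<gamma> where \<epsilon>: "\<epsilon> > 0" and \<gamma>: "\<gamma> ` {-\<epsilon><..<\<epsilon>} \<subseteq> S" "\<gamma> 0 = p"
    and deriv: "(\<gamma> has_vector_derivative t) (at 0)"
    using t(1) by (auto simp: tangent_space_def)
  \<comment> \<open>Dividing secants by \<open>s\<close> instead of by their norm gives a limit
    \<open>t\<close> directly; as \<open>t \<noteq> 0\<close>, normalising afterwards is continuous
    there.\<close>
  define q where "q s = (\<gamma> s - p) /\<^sub>R s" for s
  have "((\<lambda>s. norm (\<gamma> s - p - s *\<^sub>R t) / norm s) \<longlongrightarrow> 0) (at 0)"
    using deriv \<gamma>(2) by (simp add: has_vector_derivative_def has_derivative_at)
  moreover have "norm (\<gamma> s - p - s *\<^sub>R t) / norm s = norm (q s - t)" if "s \<noteq> 0" for s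
  proof -
    have "\<gamma> s - p - s *\<^sub>R t = s *\<^sub>R (q s - t)"
      using that by (simp add: q_def scaleR_diff_right)
    then show ?thesis
      using that by simp
  qed
  ultimately have "((\<lambda>s. norm (q s - t)) \<longlongrightarrow> 0) (at 0)"
    by (simp cong: LIM_cong)
  then have q: "(q \<longlongrightarrow> t) (at 0)"
    by (simp add: tendsto_norm_zero_iff flip: LIM_zero_iff[of _ t])
  interpret f: bounded_linear f
    using f by (simp add: linear_conv_bounded_linear)
  have "((\<lambda>s. ennreal ((f (q s) / norm (q s))\<^sup>2)) \<longlongrightarrow> ennreal ((f t / norm t)\<^sup>2)) (at 0)"
    using t(2) by (intro tendsto_intros f.tendsto q) auto
  moreover have "\<forall>\<^sub>F s in at 0. ennreal ((f (q s) / norm (q s))\<^sup>2) \<le> ?sup"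
  proof -
    have "\<forall>\<^sub>F s in at 0. q s \<noteq> 0"
      using q t(2) by (rule tendsto_imp_eventually_ne)
    moreover have "\<forall>\<^sub>F s in at 0. s \<in> {-\<epsilon><..<\<epsilon>}"
      using \<epsilon> by (intro eventually_at_in_open') auto
    moreover have "\<forall>\<^sub>F s in at (0::real). s \<noteq> 0"
      by (rule eventually_neq_at_within)
    ultimately show ?thesis
    proof eventually_elim
      case (elim s)
      \<comment> \<open>The secant is a nonzero multiple of \<open>q s\<close>, and the squared
        quotient is invariant under such scaling, sign included.\<close>
      have x: "p - \<gamma> s = (- s) *\<^sub>R q s"
        using elim by (simp add: q_def)
      have "p - \<gamma> s \<in> (\<lambda>q. p - q) ` S - {0}"
        using elim \<gamma>(1) by (auto simp: q_def intro!: imageI)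
      moreover have "(f (p - \<gamma> s) / norm (p - \<gamma> s))\<^sup>2 = (f (q s) / norm (q s))\<^sup>2"
        unfolding x f.scaleR using elim by (simp add: power_divide power_mult_distrib)
      ultimately show ?case
        by (metis (no_types, lifting) SUP_upper)
    qed
  qed
  \<comment> \<open>An eventual upper bound passes to the limit because the filter
    \<open>at 0\<close> on the reals is nontrivial.\<close>
  ultimately show ?thesis
    by (rule tendsto_upperbound) simp
qed

theorem theorem17:
  fixes \<rho> :: "'y measure"
    and w u u\<^sub>M :: "'y \<Rightarrow> real"
    and M N :: "('y \<Rightarrow> real) set"
    and \<iota> :: "'e::euclidean_space \<Rightarrow> 'y \<Rightarrow> real"
  assumes "prob_space \<rho>"
    and "weight_function \<rho> w"
    and "M \<subseteq> weighted_space \<rho> w"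
    and "u \<in> weighted_space \<rho> w"
    and "is_best_approx \<rho> M u u\<^sub>M"
    and "euclidean_coords \<rho> w \<iota>"
    and "manifold_of_functions \<iota> N"
    and "is_neighbourhood_in \<rho> w M u\<^sub>M N"
    and "local_reach \<rho> w N u\<^sub>M > 0"
  shows "\<forall>y\<in>space \<rho>.
    variation \<rho> (tangent_functions \<iota> N u\<^sub>M) y \<le> variation \<rho> ((\<lambda>v y. u\<^sub>M y - v y) ` N) y"
proof
  fix y
  have lin: "linear (\<lambda>x. \<iota> x y)" for y
    using assms(6) by (simp add: euclidean_coords_def)
  have N: "N = \<iota> ` (\<iota> -` N)"
    using assms(7) by (auto simp: manifold_of_functions_def)
  have diff: "(\<lambda>y. \<iota> p y - \<iota> q y) = \<iota> (p - q)" for p q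
    using linear_diff[OF lin] by (intro ext) simp
  \<comment> \<open>Linearity of \<open>\<iota>\<close> turns differences of functions into images
    of coordinate differences, the form that \<open>variation_euclidean_coords\<close>
    expects.\<close>
  have secants: "(\<lambda>v y. \<iota> p y - v y) ` N = \<iota> ` (\<lambda>q. p - q) ` (\<iota> -` N)" for p
    by (subst N) (simp only: image_image diff)
  have "ennreal (\<bar>a y\<bar>\<^sup>2) \<le> variation \<rho> ((\<lambda>v y. u\<^sub>M y - v y) ` N) y"
    if a_in: "a \<in> normalised \<rho> (tangent_functions \<iota> N u\<^sub>M)" for a
  proof -
    obtain t p where p: "\<iota> p = u\<^sub>M" and t: "t \<in> tangent_space (\<iota> -` N) p"
      and "\<not> (AE y in \<rho>. \<iota> t y = 0)" "a = (\<lambda>y. \<iota> t y / l2_norm \<rho> (\<iota> t))"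
      using a_in unfolding normalised_def tangent_functions_def by blast
    then have t0: "t \<noteq> 0" and a: "a = (\<lambda>y. \<iota> t y / norm t)"
      by (simp_all add: euclidean_coords_l2_norm[OF assms(6)]
          euclidean_coords_AE_zero_iff[OF assms(6)])
    show ?thesis
      using tangent_quotient_le_SUP_secants[OF lin[of y] t t0]
      by (simp add: a power_divide secants variation_euclidean_coords[OF assms(6)] flip: p)
  qed
  then show "variation \<rho> (tangent_functions \<iota> N u\<^sub>M) y \<le> variation \<rho> ((\<lambda>v y. u\<^sub>M y - v y) ` N) y"
    unfolding variation_def[of \<rho> "tangent_functions \<iota> N u\<^sub>M"] by (rule SUP_least)
qed

end
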